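(* Let $G$ be a finite abelian group, let $j:G\to\hat G$ be a bijection, and let $P=(\tilde j\circ\mathcal{F})^2:\mathbb{C}^G\to\mathbb{C}^G$. Then $P$ is a permutation, i.e. there is a bijection $p:G\to G$ with $P(f)=f\circ p$ for all $f\in\mathbb{C}^G$, if and only if $j$ is a group isomorphism. In this case $p=\hat j^{-1}\circ j$, and $p$ is a group isomorphism $G\to G$.
   Context: For a finite abelian group $G$ (written multiplicatively), $\mathbb{C}^G$ is the complex vector space of all functions $G\to\mathbb{C}$. The dual group $\hat G$ is the group of homomorphisms $\chi:G\to S^1=\{z\in\mathbb{C}:|z|=1\}$ under pointwise multiplication. The Fourier transform $\mathcal{F}:\mathbb{C}^G\to\mathbb{C}^{\hat G}$ is the linear map $$\mathcal{F}(f)(\chi)=\frac{1}{\sqrt{|G|}}\sum_{g\in G}f(g)\chi(g).$$ A bijection $j:G\to\hat G$ induces the linear map $\tilde j:\mathbb{C}^{\hat G}\to\mathbb{C}^G$, $\tilde j(\phi)(g)=\phi(j(g))$. The dual function of $j$ is $\hat j:G\to\mathbb{C}^G$, $\hat j(h)(x)=\overline{j(x)(h)}$. When $j$ is an isomorphism, $\hat j$ is an isomorphism of $G$ onto $\hat G\subset\mathbb{C}^G$, so $\hat j^{-1}:\hat G\to G$ makes sense. *)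

theory Defs
  imports Complex_Main "HOL-Algebra.Algebra"
begin

definition circle_group :: "complex monoid" where
  "circle_group = \<lparr>carrier = {z. cmod z = 1}, monoid.mult = (*), monoid.one = 1\<rparr>"

text \<open>
  Functions on a group are represented by their extensional representatives (value
  \<open>undefined\<close> off the carrier), so that equality of representatives is equality of functions
  on the group.
\<close>

definition complex_functions :: "('a, 'b) monoid_scheme \<Rightarrow> ('a \<Rightarrow> complex) set" where
  "complex_functions G = carrier G \<rightarrow>\<^sub>E UNIV"

definition dual_group :: "('a, 'b) monoid_scheme \<Rightarrow> ('a \<Rightarrow> complex) monoid" where
  "dual_group G =
    \<lparr>carrier = hom G circle_group \<inter> extensional (carrier G),
     monoid.mult = (\<lambda>\<chi> \<psi>. \<lambda>g\<in>carrier G. \<chi> g * \<psi> g),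
     monoid.one = (\<lambda>g\<in>carrier G. 1)\<rparr>"

definition fourier ::
  "('a, 'b) monoid_scheme \<Rightarrow> ('a \<Rightarrow> complex) \<Rightarrow> ('a \<Rightarrow> complex) \<Rightarrow> complex" where
  "fourier G f =
    (\<lambda>\<chi>\<in>carrier (dual_group G).
       1 / complex_of_real (sqrt (real (order G))) * (\<Sum>g\<in>carrier G. f g * \<chi> g))"

definition pull_back ::
  "('a, 'b) monoid_scheme \<Rightarrow> ('a \<Rightarrow> 'a \<Rightarrow> complex) \<Rightarrow>
    (('a \<Rightarrow> complex) \<Rightarrow> complex) \<Rightarrow> 'a \<Rightarrow> complex" where
  "pull_back G j \<phi> = (\<lambda>g\<in>carrier G. \<phi> (j g))"

definition dual_function ::
  "('a, 'b) monoid_scheme \<Rightarrow> ('a \<Rightarrow> 'a \<Rightarrow> complex) \<Rightarrow> 'a \<Rightarrow> 'a \<Rightarrow> complex" where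
  "dual_function G j h = (\<lambda>x\<in>carrier G. cnj (j x h))"

definition fourier_square ::
  "('a, 'b) monoid_scheme \<Rightarrow> ('a \<Rightarrow> 'a \<Rightarrow> complex) \<Rightarrow> ('a \<Rightarrow> complex) \<Rightarrow> 'a \<Rightarrow> complex" where
  "fourier_square G j = (pull_back G j \<circ> fourier G) ^^ 2"

definition permutes_functions_by ::
  "('a, 'b) monoid_scheme \<Rightarrow> (('a \<Rightarrow> complex) \<Rightarrow> 'a \<Rightarrow> complex) \<Rightarrow> ('a \<Rightarrow> 'a) \<Rightarrow> bool" where
  "permutes_functions_by G P p \<longleftrightarrow>
    bij_betw p (carrier G) (carrier G) \<and>
    (\<forall>f\<in>complex_functions G. P f = compose (carrier G) f p)"

end

theory Submission
  imports Defs
begin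

text \<open>
  Write \<open>n\<close> for the order of \<open>G\<close> and \<open>M\<close> for the matrix with entries \<open>j(x)(g)\<close>, so that
  \<open>P = M\<^sup>2 / n\<close>. If \<open>P\<close> is the permutation \<open>p\<close>, then the entry of \<open>M\<^sup>2\<close> at \<open>(x, p x)\<close> is a sum of
  \<open>n\<close> complex numbers of modulus one with value \<open>n\<close>; hence each summand \<open>j(x)(g) j(g)(p x)\<close> is \<open>1\<close>,
  that is, the dual function maps \<open>p x\<close> to \<open>j x\<close>. Thus \<open>j(g)(p x)\<close> is multiplicative in \<open>g\<close>, and as
  \<open>p\<close> is onto, \<open>j\<close> is a homomorphism. Conversely, if \<open>j\<close> is an isomorphism then so is its dual
  function, and orthogonality of characters evaluates the entries of \<open>M\<^sup>2\<close>.

  The dual function is injective because characters separate points. As \<open>j\<close> already provides \<open>n\<close>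
  characters, this follows by summing \<open>\<chi> h\<close> over all \<open>\<chi>\<close> and \<open>h\<close>: summing over \<open>h\<close> first gives \<open>n\<close>,
  summing over \<open>\<chi>\<close> first gives \<open>n\<close> times the number of points on which all characters are trivial.
\<close>

section \<open>Characters and their orthogonality over the group\<close>

lemma mult_cnj_norm_one:
  assumes "cmod z = 1"
  shows "z * cnj z = 1" "cnj z * z = 1"
  using assms complex_norm_square[of z] by (simp_all add: mult.commute)

lemma dual_groupI:
  assumes "\<chi> \<in> extensional (carrier G)"
    and "\<And>x. x \<in> carrier G \<Longrightarrow> cmod (\<chi> x) = 1"
    and "\<And>x y. x \<in> carrier G \<Longrightarrow> y \<in> carrier G \<Longrightarrow> \<chi> (x \<otimes>\<^bsub>G\<^esub> y) = \<chi> x * \<chi> y"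
  shows "\<chi> \<in> carrier (dual_group G)"
  using assms by (auto simp: dual_group_def hom_def circle_group_def)

lemma dual_groupD:
  assumes "\<chi> \<in> carrier (dual_group G)"
  shows "\<chi> \<in> extensional (carrier G)"
    and "x \<in> carrier G \<Longrightarrow> cmod (\<chi> x) = 1"
    and "x \<in> carrier G \<Longrightarrow> y \<in> carrier G \<Longrightarrow> \<chi> (x \<otimes>\<^bsub>G\<^esub> y) = \<chi> x * \<chi> y"
  using assms by (auto simp: dual_group_def hom_def circle_group_def)

lemma mult_dual_group:
  "\<chi> \<otimes>\<^bsub>dual_group G\<^esub> \<psi> = (\<lambda>g\<in>carrier G. \<chi> g * \<psi> g)"
  by (simp add: dual_group_def)

lemma one_dual_group: "\<one>\<^bsub>dual_group G\<^esub> = (\<lambda>g\<in>carrier G. 1)"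
  by (simp add: dual_group_def)

context group
begin

lemma mult_dual_group_closed:
  assumes "\<chi> \<in> carrier (dual_group G)" "\<psi> \<in> carrier (dual_group G)"
  shows "\<chi> \<otimes>\<^bsub>dual_group G\<^esub> \<psi> \<in> carrier (dual_group G)"
  using assms
  by (intro dual_groupI) (auto simp: mult_dual_group dual_groupD(2,3) norm_mult)

lemma one_dual_group_closed: "\<one>\<^bsub>dual_group G\<^esub> \<in> carrier (dual_group G)"
  by (intro dual_groupI) (auto simp: one_dual_group)

lemma character_ne_zero:
  assumes "\<chi> \<in> carrier (dual_group G)" "x \<in> carrier G"
  shows "\<chi> x \<noteq> 0"
  using dual_groupD(2)[OF assms] by auto

lemma character_one:
  assumes "\<chi> \<in> carrier (dual_group G)"
  shows "\<chi> \<one> = 1"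
  using dual_groupD(3)[OF assms, of \<one> \<one>] character_ne_zero[OF assms, of \<one>] by simp

text \<open>Translation by a point \<open>a\<close> with \<open>\<chi> a \<noteq> 1\<close> permutes
  the group and multiplies the sum by \<open>\<chi> a\<close>, so a nontrivial character sums to
  0.\<close>

lemma character_sum:
  assumes \<chi>: "\<chi> \<in> carrier (dual_group G)"
  shows "(\<Sum>g\<in>carrier G. \<chi> g) = (if \<chi> = \<one>\<^bsub>dual_group G\<^esub> then of_nat (order G) else 0)"
proof (cases "\<chi> = \<one>\<^bsub>dual_group G\<^esub>")
  case True
  then show ?thesis by (simp add: one_dual_group order_def)
next
  case False
  then obtain a where a: "a \<in> carrier G" "\<chi> a \<noteq> 1"
    using extensionalityI[OF dual_groupD(1)[OF \<chi>] dual_groupD(1)[OF one_dual_group_closed]]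
    by (auto simp: one_dual_group)
  have "bij_betw (\<lambda>g. a \<otimes> g) (carrier G) (carrier G)"
    using a by (simp add: bij_betw_def inj_on_cmult surj_const_mult)
  then have "(\<Sum>g\<in>carrier G. \<chi> g) = (\<Sum>g\<in>carrier G. \<chi> (a \<otimes> g))"
    by (rule sum.reindex_bij_betw[symmetric])
  also have "\<dots> = \<chi> a * (\<Sum>g\<in>carrier G. \<chi> g)"
    using a by (simp add: dual_groupD(3)[OF \<chi>] sum_distrib_left)
  finally show ?thesis using a False by simp
qed

text \<open>The product of \<open>\<chi>\<close> with the conjugate of \<open>\<psi>\<close> is
  again a character, trivial exactly when the two agree; \<open>character_sum\<close> then evaluates
  it.\<close>

lemma character_orthogonality:
  assumes \<chi>: "\<chi> \<in> carrier (dual_group G)" and \<psi>: "\<psi> \<in> carrier (dual_group G)"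
  shows "(\<Sum>g\<in>carrier G. \<chi> g * cnj (\<psi> g)) = (if \<chi> = \<psi> then of_nat (order G) else 0)"
proof -
  let ?\<phi> = "\<lambda>g\<in>carrier G. \<chi> g * cnj (\<psi> g)"
  have \<phi>: "?\<phi> \<in> carrier (dual_group G)"
    using \<chi> \<psi> by (intro dual_groupI) (auto simp: dual_groupD(2,3) norm_mult)
  have "?\<phi> = \<one>\<^bsub>dual_group G\<^esub> \<longleftrightarrow> \<chi> = \<psi>"
  proof
    assume eq: "?\<phi> = \<one>\<^bsub>dual_group G\<^esub>"
    show "\<chi> = \<psi>"
    proof (rule extensionalityI[OF dual_groupD(1)[OF \<chi>] dual_groupD(1)[OF \<psi>]])
      fix g assume g: "g \<in> carrier G"
      have "\<chi> g * cnj (\<psi> g) = 1"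
        using fun_cong[OF eq, of g] g by (simp add: one_dual_group)
      then have "\<chi> g * (cnj (\<psi> g) * \<psi> g) = \<psi> g"
        by (simp flip: mult.assoc)
      then show "\<chi> g = \<psi> g"
        by (simp add: mult_cnj_norm_one dual_groupD(2)[OF \<psi> g])
    qed
  next
    assume "\<chi> = \<psi>"
    then show "?\<phi> = \<one>\<^bsub>dual_group G\<^esub>"
      by (auto simp: one_dual_group fun_eq_iff mult_cnj_norm_one dual_groupD(2)[OF \<psi>])
  qed
  with character_sum[OF \<phi>] show ?thesis by simp
qed

section \<open>Sums over the dual group and separation of points\<close>

lemma dual_character_sum:
  assumes fin: "finite (carrier (dual_group G))"
    and h: "h \<in> carrier G" and \<psi>: "\<psi> \<in> carrier (dual_group G)" "\<psi> h \<noteq> 1"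
  shows "(\<Sum>\<chi>\<in>carrier (dual_group G). \<chi> h) = 0"
proof -
  let ?D = "carrier (dual_group G)" and ?m = "\<lambda>\<chi>. \<psi> \<otimes>\<^bsub>dual_group G\<^esub> \<chi>"
  have "inj_on ?m ?D"
  proof (rule inj_onI)
    fix \<chi> \<chi>' assume D: "\<chi> \<in> ?D" "\<chi>' \<in> ?D" and eq: "?m \<chi> = ?m \<chi>'"
    show "\<chi> = \<chi>'"
    proof (rule extensionalityI[OF dual_groupD(1)[OF D(1)] dual_groupD(1)[OF D(2)]])
      fix g assume "g \<in> carrier G"
      then show "\<chi> g = \<chi>' g"
        using fun_cong[OF eq, of g] character_ne_zero[OF \<psi>(1)] by (simp add: mult_dual_group)
    qed
  qed
  moreover have "?m ` ?D \<subseteq> ?D"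
    using \<psi>(1) by (auto intro: mult_dual_group_closed)
  \<comment> \<open>An injective self-map of a finite set is onto, so inverse characters never have
    to be constructed.\<close>
  ultimately have "bij_betw ?m ?D ?D"
    using endo_inj_surj[OF fin] by (simp add: bij_betw_def)
  then have "(\<Sum>\<chi>\<in>?D. \<chi> h) = (\<Sum>\<chi>\<in>?D. ?m \<chi> h)"
    by (rule sum.reindex_bij_betw[where g = "\<lambda>\<chi>. \<chi> h", symmetric])
  also have "\<dots> = \<psi> h * (\<Sum>\<chi>\<in>?D. \<chi> h)"
    using h by (simp add: mult_dual_group sum_distrib_left)
  finally show ?thesis using \<psi>(2) by simp
qed

lemma characters_separate_one:
  assumes fin: "finite (carrier G)" and card: "card (carrier (dual_group G)) = order G"
    and h: "h \<in> carrier G" and trivial: "\<And>\<chi>. \<chi> \<in> carrier (dual_group G) \<Longrightarrow> \<chi> h = 1"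
  shows "h = \<one>"
proof -
  let ?D = "carrier (dual_group G)"
  define K where "K = {k \<in> carrier G. \<forall>\<chi>\<in>?D. \<chi> k = 1}"
  have pos: "order G > 0"
    using fin by (simp add: order_gt_0_iff_finite)
  then have finD: "finite ?D"
    using card card_ge_0_finite by metis
  have "complex_of_nat (card K * order G) = (\<Sum>k\<in>carrier G. \<Sum>\<chi>\<in>?D. \<chi> k)"
  proof -
    \<comment> \<open>\<open>K\<close> is the common kernel of all characters; at a point outside it
      some character is not 1, so the inner sum vanishes.\<close>
    have "(\<Sum>k\<in>carrier G. \<Sum>\<chi>\<in>?D. \<chi> k) = (\<Sum>k\<in>K. \<Sum>\<chi>\<in>?D. \<chi> k)"
      using fin dual_character_sum[OF finD]
      by (intro sum.mono_neutral_right) (auto simp: K_def)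
    also have "\<dots> = (\<Sum>k\<in>K. \<Sum>\<chi>\<in>?D. 1)"
      by (intro sum.cong) (auto simp: K_def)
    finally show ?thesis by (simp add: card)
  qed
  also have "\<dots> = (\<Sum>\<chi>\<in>?D. \<Sum>k\<in>carrier G. \<chi> k)"
    by (rule sum.swap)
  also have "\<dots> = of_nat (order G)"
    using finD one_dual_group_closed by (simp add: character_sum)
  finally have "card K = 1"
    using pos by (simp only: of_nat_eq_iff) simp
  moreover have "h \<in> K" "\<one> \<in> K"
    using h trivial by (auto simp: K_def character_one)
  ultimately show ?thesis
    by (metis card_1_singletonE singletonD)
qed

lemma characters_separate:
  assumes "finite (carrier G)" and "card (carrier (dual_group G)) = order G"
    and h: "h \<in> carrier G" "h' \<in> carrier G"
    and eq: "\<And>\<chi>. \<chi> \<in> carrier (dual_group G) \<Longrightarrow> \<chi> h = \<chi> h'"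
  shows "h = h'"
proof -
  have "h \<otimes> inv h' = \<one>"
  proof (rule characters_separate_one[OF assms(1,2)])
    fix \<chi> assume \<chi>: "\<chi> \<in> carrier (dual_group G)"
    show "\<chi> (h \<otimes> inv h') = 1"
      using dual_groupD(3)[OF \<chi>, of _ "inv h'"] eq[OF \<chi>] h character_one[OF \<chi>]
      by (metis inv_closed r_inv)
  qed (use h in simp)
  then show ?thesis
    using h inv_equality by fastforce
qed

section \<open>Matrix entries of the squared transform\<close>

lemma fourier_square_apply:
  assumes "finite (carrier G)" and j: "j \<in> carrier G \<rightarrow> carrier (dual_group G)"
    and x: "x \<in> carrier G"
  shows "fourier_square G j f x =
    (\<Sum>h\<in>carrier G. f h * (\<Sum>g\<in>carrier G. j x g * j g h)) / of_nat (order G)"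
proof -
  define c where "c = 1 / complex_of_real (sqrt (real (order G)))"
  have cc: "c * c = 1 / of_nat (order G)"
    by (simp add: c_def flip: of_real_mult)
  \<comment> \<open>Values of \<open>j\<close> lie in the dual group, so the transform is never
    evaluated where it is \<open>undefined\<close>.\<close>
  have "fourier_square G j f x =
      c * (\<Sum>g\<in>carrier G. c * (\<Sum>h\<in>carrier G. f h * j g h) * j x g)"
    using j x
    by (simp add: fourier_square_def numeral_2_eq_2 pull_back_def fourier_def c_def Pi_iff)
  also have "\<dots> = (c * c) * (\<Sum>g\<in>carrier G. \<Sum>h\<in>carrier G. f h * (j x g * j g h))"
    by (simp add: sum_distrib_left sum_distrib_right mult_ac)
  also have "\<dots> = (c * c) * (\<Sum>h\<in>carrier G. f h * (\<Sum>g\<in>carrier G. j x g * j g h))"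
    by (subst sum.swap) (simp add: sum_distrib_left)
  finally show ?thesis by (simp add: cc)
qed

end

text \<open>Equality case of the triangle inequality: the defects \<open>1 - Re (u b)\<close> are
  nonnegative and add up to 0, and a number of modulus one with real part one is 1.\<close>

lemma sum_norm_one_eq_card:
  fixes u :: "'a \<Rightarrow> complex"
  assumes fin: "finite A" and norm: "\<And>a. a \<in> A \<Longrightarrow> cmod (u a) = 1"
    and sum: "(\<Sum>a\<in>A. u a) = of_nat (card A)" and a: "a \<in> A"
  shows "u a = 1"
proof -
  have le: "Re (u b) \<le> 1" if "b \<in> A" for b
    using norm[OF that] complex_Re_le_cmod[of "u b"] by simp
  have "(\<Sum>b\<in>A. 1 - Re (u b)) = 0"
    using arg_cong[OF sum, of Re] by (simp add: sum_subtractf)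
  then have "Re (u a) = 1"
    using sum_nonneg_eq_0_iff[OF fin, of "\<lambda>b. 1 - Re (u b)"] le a by simp
  with norm[OF a] show ?thesis
    by (simp add: complex_eq_iff cmod_def)
qed

text \<open>Serves twice: to show that \<open>j\<close> is a homomorphism, and later to identify
  \<open>p\<close>.\<close>

lemma (in group) dual_function_permutation:
  assumes fin: "finite (carrier G)" and j: "j \<in> carrier G \<rightarrow> carrier (dual_group G)"
    and p: "permutes_functions_by G (fourier_square G j) p" and x: "x \<in> carrier G"
  shows "dual_function G j (p x) = j x"
proof -
  have px: "p x \<in> carrier G"
    using p x by (auto simp: permutes_functions_by_def bij_betw_def)
  \<comment> \<open>The indicator of \<open>p x\<close> extracts the matrix entry at
    \<open>(x, p x)\<close>; composed with \<open>p\<close> it takes the value 1 at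
    \<open>x\<close>.\<close>
  let ?\<delta> = "\<lambda>h\<in>carrier G. if h = p x then 1 else 0 :: complex"
  let ?s = "\<Sum>g\<in>carrier G. j x g * j g (p x)"
  have "fourier_square G j ?\<delta> x = 1"
    using p x px by (simp add: permutes_functions_by_def complex_functions_def compose_def)
  moreover have "(\<Sum>h\<in>carrier G. ?\<delta> h * (\<Sum>g\<in>carrier G. j x g * j g h)) = ?s"
  proof -
    have "(\<Sum>h\<in>carrier G. ?\<delta> h * (\<Sum>g\<in>carrier G. j x g * j g h)) =
        (\<Sum>h\<in>carrier G. if h = p x then (\<Sum>g\<in>carrier G. j x g * j g h) else 0)"
      by (intro sum.cong) auto
    then show ?thesis using fin px by simp
  qed
  ultimately have "1 = ?s / of_nat (order G)"
    using fourier_square_apply[OF fin j x, of ?\<delta>] by (simp only:)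
  then have sum: "?s = of_nat (card (carrier G))"
    by (metis divide_eq_1_iff order_def)
  have dual: "j g \<in> carrier (dual_group G)" if "g \<in> carrier G" for g
    using j that by auto
  have "cnj (j g (p x)) = j x g" if g: "g \<in> carrier G" for g
  proof -
    have "j x g * j g (p x) = 1"
      using x px
      by (intro sum_norm_one_eq_card[OF fin _ sum g]) (simp add: norm_mult dual_groupD(2)[OF dual])
    then have "j x g * (j g (p x) * cnj (j g (p x))) = cnj (j g (p x))"
      by (simp flip: mult.assoc)
    then show ?thesis
      by (simp add: mult_cnj_norm_one dual_groupD(2)[OF dual[OF g] px])
  qed
  then show ?thesis
    using dual_groupD(1)[OF dual[OF x]]
    by (intro extensionalityI[of _ "carrier G"]) (auto simp: dual_function_def)
qed

section \<open>The two directions of the equivalence\<close>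

lemma (in group) iso_if_permutation:
  assumes fin: "finite (carrier G)"
    and bij: "bij_betw j (carrier G) (carrier (dual_group G))"
    and p: "permutes_functions_by G (fourier_square G j) p"
  shows "j \<in> iso G (dual_group G)"
proof -
  have j: "j \<in> carrier G \<rightarrow> carrier (dual_group G)"
    using bij by (rule bij_betw_imp_funcset)
  have dual: "j g \<in> carrier (dual_group G)" if "g \<in> carrier G" for g
    using j that by auto
  have "j (a \<otimes> b) = j a \<otimes>\<^bsub>dual_group G\<^esub> j b" if ab: "a \<in> carrier G" "b \<in> carrier G" for a b
  proof (rule extensionalityI[of _ "carrier G"])
    fix h assume "h \<in> carrier G"
    then obtain x where x: "x \<in> carrier G" "h = p x"
      using p by (auto simp: permutes_functions_by_def bij_betw_def)
    \<comment> \<open>Evaluating a varying \<open>j g\<close> at the fixed point \<open>h\<close>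
      becomes, up to conjugation, evaluating the fixed character \<open>j x\<close> at
      \<open>g\<close>, which is multiplicative in \<open>g\<close>.\<close>
    have *: "j g h = cnj (j x g)" if "g \<in> carrier G" for g
      using fun_cong[OF dual_function_permutation[OF fin j p x(1)], of g] that
      by (simp add: dual_function_def x(2) complex_cnj_cancel_iff[of "j g (p x)", symmetric])
    show "j (a \<otimes> b) h = (j a \<otimes>\<^bsub>dual_group G\<^esub> j b) h"
      using ab \<open>h \<in> carrier G\<close> by (simp add: * mult_dual_group dual_groupD(3)[OF dual[OF x(1)]])
  qed (use ab dual in \<open>auto simp: mult_dual_group dual_groupD(1)\<close>)
  then show ?thesis
    using bij dual by (auto simp: iso_def hom_def)
qed

text \<open>The two variables exchange roles: multiplicativity of \<open>j\<close> makes each value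
  of the dual function a character, and multiplicativity of each \<open>j x\<close> makes the dual
  function a homomorphism. Injectivity is separation of points; surjectivity follows by
  counting.\<close>

lemma (in group) dual_function_iso:
  assumes fin: "finite (carrier G)" and j: "j \<in> iso G (dual_group G)"
  shows "dual_function G j \<in> iso G (dual_group G)"
proof -
  let ?d = "dual_function G j" and ?D = "carrier (dual_group G)"
  have bij: "bij_betw j (carrier G) ?D"
    and hom: "\<And>a b. a \<in> carrier G \<Longrightarrow> b \<in> carrier G \<Longrightarrow> j (a \<otimes> b) = j a \<otimes>\<^bsub>dual_group G\<^esub> j b"
    using j by (auto simp: iso_def hom_def)
  have dual: "j g \<in> ?D" if "g \<in> carrier G" for g
    using bij that by (auto simp: bij_betw_def)
  have card: "card ?D = order G"
    using bij_betw_same_card[OF bij] by (simp add: order_def)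
  have closed: "?d h \<in> ?D" if "h \<in> carrier G" for h
    using that
    by (intro dual_groupI)
      (auto simp: dual_function_def hom mult_dual_group dual_groupD(2)[OF dual])
  have inj: "inj_on ?d (carrier G)"
  proof (rule inj_onI)
    fix h h' assume h: "h \<in> carrier G" "h' \<in> carrier G" and eq: "?d h = ?d h'"
    show "h = h'"
    proof (rule characters_separate[OF fin card h])
      fix \<chi> assume "\<chi> \<in> ?D"
      then obtain x where "x \<in> carrier G" "\<chi> = j x"
        using bij by (auto simp: bij_betw_def)
      then show "\<chi> h = \<chi> h'"
        using fun_cong[OF eq, of x] by (simp add: dual_function_def)
    qed
  qed
  have finD: "finite ?D"
    using bij fin bij_betw_finite by blast
  have "?d ` carrier G = ?D"
    using finD closed inj card by (intro card_subset_eq) (auto simp: card_image order_def)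
  moreover have "?d (a \<otimes> b) = ?d a \<otimes>\<^bsub>dual_group G\<^esub> ?d b"
    if "a \<in> carrier G" "b \<in> carrier G" for a b
    using that
    by (auto simp: dual_function_def mult_dual_group fun_eq_iff dual_groupD(3)[OF dual])
  ultimately show ?thesis
    using inj closed by (auto simp: iso_def hom_def bij_betw_def)
qed

text \<open>Since \<open>j g h\<close> is the conjugate of the dual function of \<open>h\<close> at
  \<open>g\<close>, each entry of the squared matrix is an inner product of two characters.\<close>

lemma (in group) permutation_if_iso:
  assumes fin: "finite (carrier G)" and j: "j \<in> iso G (dual_group G)"
  shows "permutes_functions_by G (fourier_square G j)
    (\<lambda>x. inv_into (carrier G) (dual_function G j) (j x))"
proof -
  let ?d = "dual_function G j" and ?D = "carrier (dual_group G)"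
  let ?p = "\<lambda>x. inv_into (carrier G) ?d (j x)"
  have bij: "bij_betw j (carrier G) ?D"
    using j by (simp add: iso_def)
  have bijd: "bij_betw ?d (carrier G) ?D"
    using dual_function_iso[OF fin j] by (simp add: iso_def)
  have bijp: "bij_betw ?p (carrier G) (carrier G)"
    using bij_betw_trans[OF bij bij_betw_inv_into[OF bijd]] by (simp add: o_def)
  have sum: "(\<Sum>g\<in>carrier G. j x g * j g h) = (if h = ?p x then of_nat (order G) else 0)"
    if x: "x \<in> carrier G" and h: "h \<in> carrier G" for x h
  proof -
    have D: "j x \<in> ?D" "?d h \<in> ?D"
      using bij bijd x h by (auto simp: bij_betw_def)
    have "(\<Sum>g\<in>carrier G. j x g * j g h) = (\<Sum>g\<in>carrier G. j x g * cnj (?d h g))"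
      by (intro sum.cong) (auto simp: dual_function_def)
    also have "\<dots> = (if j x = ?d h then of_nat (order G) else 0)"
      by (rule character_orthogonality[OF D])
    also have "j x = ?d h \<longleftrightarrow> h = ?p x"
      using bij_betw_inv_into_left[OF bijd h] bij_betw_inv_into_right[OF bijd D(1)] by auto
    finally show ?thesis .
  qed
  have pos: "order G > 0"
    using fin by (simp add: order_gt_0_iff_finite)
  have "fourier_square G j f x = f (?p x)" if x: "x \<in> carrier G" for f x
  proof -
    have "fourier_square G j f x =
        (\<Sum>h\<in>carrier G. f h * (\<Sum>g\<in>carrier G. j x g * j g h)) / of_nat (order G)"
      by (rule fourier_square_apply[OF fin bij_betw_imp_funcset[OF bij] x])
    also have "\<dots> = (\<Sum>h\<in>carrier G. if h = ?p x then f h * of_nat (order G) else 0) /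
        of_nat (order G)"
      by (intro arg_cong2[where f = "(/)"] sum.cong) (auto simp: sum[OF x])
    also have "\<dots> = f (?p x)"
      using fin pos bij_betwE[OF bijp] x by simp
    finally show ?thesis .
  qed
  then have "fourier_square G j f = compose (carrier G) f ?p" for f
    \<comment> \<open>Off the carrier both functions are \<open>undefined\<close>.\<close>
    by (intro extensionalityI[of _ "carrier G"])
      (auto simp: compose_def fourier_square_def numeral_2_eq_2 pull_back_def)
  with bijp show ?thesis
    by (simp add: permutes_functions_by_def)
qed

theorem theorem3p3:
  fixes G :: "('a, 'b) monoid_scheme"
    and j :: "'a \<Rightarrow> 'a \<Rightarrow> complex"
  assumes "comm_group G"
    and "finite (carrier G)"
    and "bij_betw j (carrier G) (carrier (dual_group G))"
  shows "((\<exists>p. permutes_functions_by G (fourier_square G j) p) \<longleftrightarrow> j \<in> iso G (dual_group G)) \<and>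
    (j \<in> iso G (dual_group G) \<longrightarrow>
      dual_function G j \<in> iso G (dual_group G) \<and>
      (\<forall>p. permutes_functions_by G (fourier_square G j) p \<longrightarrow>
        (\<forall>g\<in>carrier G. p g = inv_into (carrier G) (dual_function G j) (j g)) \<and>
        p \<in> iso G G))"
proof -
  interpret comm_group G by fact
  note fin = assms(2) and bij = assms(3)
  let ?d = "dual_function G j"
  have "(\<forall>g\<in>carrier G. p g = inv_into (carrier G) ?d (j g)) \<and> p \<in> iso G G"
    if j: "j \<in> iso G (dual_group G)" and p: "permutes_functions_by G (fourier_square G j) p" for p
  proof -
    have d: "?d \<in> hom G (dual_group G)" "inj_on ?d (carrier G)"
      using dual_function_iso[OF fin j] by (auto simp: iso_def bij_betw_def)
    have bijp: "bij_betw p (carrier G) (carrier G)"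
      using p by (simp add: permutes_functions_by_def)
    have closed: "p x \<in> carrier G" if "x \<in> carrier G" for x
      using bijp that by (auto simp: bij_betw_def)
    have dp: "?d (p x) = j x" if "x \<in> carrier G" for x
      using dual_function_permutation[OF fin bij_betw_imp_funcset[OF bij] p that] .
    \<comment> \<open>The injective homomorphism \<open>?d\<close> carries this to multiplicativity
      of \<open>j\<close>, because \<open>?d (p x) = j x\<close>.\<close>
    have "p (x \<otimes>\<^bsub>G\<^esub> y) = p x \<otimes>\<^bsub>G\<^esub> p y" if xy: "x \<in> carrier G" "y \<in> carrier G" for x y
    proof (rule inj_onD[OF d(2)])
      have "j (x \<otimes>\<^bsub>G\<^esub> y) = j x \<otimes>\<^bsub>dual_group G\<^esub> j y"
        using j xy by (simp add: iso_def hom_def)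
      then show "?d (p (x \<otimes>\<^bsub>G\<^esub> y)) = ?d (p x \<otimes>\<^bsub>G\<^esub> p y)"
        using xy closed d(1) by (simp add: hom_mult dp)
    qed (use xy closed in auto)
    then have "p \<in> iso G G"
      using bijp closed by (auto simp: iso_def hom_def)
    moreover have "p g = inv_into (carrier G) ?d (j g)" if "g \<in> carrier G" for g
      using inv_into_f_f[OF d(2) closed[OF that]] dp[OF that] by simp
    ultimately show ?thesis by blast
  qed
  then show ?thesis
    using iso_if_permutation[OF fin bij] permutation_if_iso[OF fin] dual_function_iso[OF fin]
    by blast
qed

end
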